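(* Let $\mathscr Y=\{(U_\alpha,\phi_\alpha)\}_{\alpha\in I}$ be a visibility datum in $X\subseteq\mathbb R^n$, and write $\phi_\alpha=(\phi_{\alpha,1},\dots,\phi_{\alpha,n})$. Assume that there are positive integers $w_1,\dots,w_n$ such that, for every $\alpha\in I$, every $t\in U_\alpha$, and every real $d>0$ for which both sides are defined, one has $$\phi_\alpha(dt)=\bigl(d^{w_1}\phi_{\alpha,1}(t),\dots,d^{w_n}\phi_{\alpha,n}(t)\bigr).$$ Then visibility is locally detectable for $\mathscr Y$, that is, $$\mathcal B^{\mathrm{vis}}(\mathscr Y)=\bigcap_{p\text{ prime}}\mathcal B_p^{\mathrm{vis}}(\mathscr Y).$$
   Context: Setup. $X\subseteq\mathbb R^n$ is a fixed real affine variety defined over $\mathbb Q$ with $0\in X$; $X(\mathbb Z)=X\cap\mathbb Z^n$. An ordered branch on $X$ is a pair $(U,\phi)$ where $U\subseteq\mathbb A^1_{\mathbb R}$ is a nonempty Zariski open subset defined over $\mathbb Q$ with $0\in U(\mathbb Q)$, and $\phi:U\to X$ is the restriction of a rational map $\mathbb A^1\dashrightarrow X$ regular on $U$ (each coordinate is a quotient $f_i/g_i$ of polynomials with rational coefficients, with $g_i$ nonvanishing on $U$), such that $\phi$ is injective on $U^+:=U(\mathbb R)\cap\mathbb R_{>0}$. A visibility datum is a collection $\mathscr Y=\{(U_\alpha,\phi_\alpha)\}_{\alpha\in I}$ of ordered branches such that (1) $\phi_\alpha(0)=0$ for all $\alpha$, and if $t\in U_\alpha(\mathbb R)$ and $\phi_\alpha(t)=0$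 then $t=0$; (2) $\phi_\alpha(U_\alpha^+)\cap\phi_\beta(U_\beta^+)=\emptyset$ for $\alpha\ne\beta$. The branch locus is $\mathcal B(\mathscr Y)=\{\phi_\alpha(t)\in X(\mathbb Z):\alpha\in I,\ t\in U_\alpha^+\}$. For $P=(P_1,\dots,P_n)\in\mathbb Z^n$ and a prime $p$, $v_p(P):=\min_i v_p(P_i)$, where $v_p$ is the normalized $p$-adic valuation and $v_p(0)=+\infty$. A point $\phi_\alpha(t)\in\mathcal B(\mathscr Y)$ (with $t\in U_\alpha^+$) is globally visible if there is no $s\in U_\alpha^+$ with $0<s<t$ and $\phi_\alpha(s)\in\mathbb Z^n$. It is $p$-adically visible if for every $s\in U_\alpha^+$ with $0<s<t$ and $\phi_\alpha(s)\in\mathbb Z^n$ one has $v_p(\phi_\alpha(t))\le v_p(\phi_\alpha(s))$. $\mathcal B^{\mathrm{vis}}(\mathscr Y)$ and $\mathcal B_p^{\mathrm{vis}}(\mathscr Y)$ denote the sets of globally visible and of $p$-adically visible points of $\mathcal B(\mathscr Y)$. *)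

theory Defs
  imports "HOL-Analysis.Analysis" "HOL-Computational_Algebra.Polynomial"
    "HOL-Computational_Algebra.Primes" "HOL-Library.Poly_Mapping" "HOL-Library.Extended_Nat"
begin

type_synonym 'n rat_mpoly = "('n \<Rightarrow>\<^sub>0 nat) \<Rightarrow>\<^sub>0 rat"

definition mpoly_eval :: "'n::finite rat_mpoly \<Rightarrow> real ^ 'n \<Rightarrow> real" where
  "mpoly_eval F x =
     (\<Sum>m\<in>Poly_Mapping.keys F.
        of_rat (Poly_Mapping.lookup F m) * (\<Prod>i\<in>UNIV. (x $ i) ^ Poly_Mapping.lookup m i))"

text \<open>Varieties are closed algebraic sets, identified with their sets of real points;
  irreducibility is not required.\<close>

definition affine_variety_over_rat :: "(real ^ 'n::finite) set \<Rightarrow> bool" where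
  "affine_variety_over_rat X \<longleftrightarrow> (\<exists>S. X = {x. \<forall>F\<in>S. mpoly_eval F x = 0})"

definition integer_lattice :: "(real ^ 'n::finite) set" where
  "integer_lattice = {x. \<forall>i. x $ i \<in> \<int>}"

definition rpoly :: "rat poly \<Rightarrow> real \<Rightarrow> real" where
  "rpoly f t = poly (map_poly of_rat f) t"

text \<open>An open subset \<open>U\<close> of the affine line is likewise represented by \<open>U(\<real>)\<close>. Shrinking
  the underlying scheme by removing the non-real zeros of denominators does not change
  \<open>U(\<real>)\<close>, so asking that denominators do not vanish on \<open>U(\<real>)\<close> loses nothing.\<close>

definition zariski_open_over_rat :: "real set \<Rightarrow> bool" where
  "zariski_open_over_rat U \<longleftrightarrow> (\<exists>H. U = - {t. \<forall>h\<in>H. rpoly h t = 0})"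

definition positive_part :: "real set \<Rightarrow> real set" where
  "positive_part U = U \<inter> {0<..}"

definition ordered_branch ::
    "(real ^ 'n::finite) set \<Rightarrow> real set \<Rightarrow> (real \<Rightarrow> real ^ 'n) \<Rightarrow> bool" where
  "ordered_branch X U \<phi> \<longleftrightarrow>
     U \<noteq> {} \<and> zariski_open_over_rat U \<and> 0 \<in> U \<and>
     (\<exists>f g. \<forall>t\<in>U. \<forall>i. rpoly (g i) t \<noteq> 0 \<and> \<phi> t $ i = rpoly (f i) t / rpoly (g i) t) \<and>
     \<phi> ` U \<subseteq> X \<and>
     inj_on \<phi> (positive_part U)"

definition visibility_datum ::
    "(real ^ 'n::finite) set \<Rightarrow> 'i set \<Rightarrow> ('i \<Rightarrow> real set) \<Rightarrow> ('i \<Rightarrow> real \<Rightarrow> real ^ 'n) \<Rightarrow> bool" where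
  "visibility_datum X I U \<phi> \<longleftrightarrow>
     (\<forall>\<alpha>\<in>I. ordered_branch X (U \<alpha>) (\<phi> \<alpha>)) \<and>
     (\<forall>\<alpha>\<in>I. \<phi> \<alpha> 0 = 0 \<and> (\<forall>t\<in>U \<alpha>. \<phi> \<alpha> t = 0 \<longrightarrow> t = 0)) \<and>
     (\<forall>\<alpha>\<in>I. \<forall>\<beta>\<in>I. \<alpha> \<noteq> \<beta> \<longrightarrow>
        \<phi> \<alpha> ` positive_part (U \<alpha>) \<inter> \<phi> \<beta> ` positive_part (U \<beta>) = {})"

definition branch_locus ::
    "(real ^ 'n::finite) set \<Rightarrow> 'i set \<Rightarrow> ('i \<Rightarrow> real set) \<Rightarrow> ('i \<Rightarrow> real \<Rightarrow> real ^ 'n)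
      \<Rightarrow> (real ^ 'n) set" where
  "branch_locus X I U \<phi> =
     {\<phi> \<alpha> t | \<alpha> t. \<alpha> \<in> I \<and> t \<in> positive_part (U \<alpha>) \<and> \<phi> \<alpha> t \<in> X \<inter> integer_lattice}"

definition padic_val :: "nat \<Rightarrow> int \<Rightarrow> enat" where
  "padic_val p a = (if a = 0 then \<infinity> else enat (multiplicity (int p) a))"

text \<open>Only meaningful on \<^const>\<open>integer_lattice\<close>, where the floor merely
  converts the coordinates to type \<^typ>\<open>int\<close>.\<close>

definition padic_val_vec :: "nat \<Rightarrow> real ^ 'n::finite \<Rightarrow> enat" where
  "padic_val_vec p P = Min (range (\<lambda>i. padic_val p \<lfloor>P $ i\<rfloor>))"

definition globally_visible :: "real set \<Rightarrow> (real \<Rightarrow> real ^ 'n::finite) \<Rightarrow> real \<Rightarrow> bool" where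
  "globally_visible U \<phi> t \<longleftrightarrow>
     \<not> (\<exists>s\<in>positive_part U. 0 < s \<and> s < t \<and> \<phi> s \<in> integer_lattice)"

definition padically_visible ::
    "nat \<Rightarrow> real set \<Rightarrow> (real \<Rightarrow> real ^ 'n::finite) \<Rightarrow> real \<Rightarrow> bool" where
  "padically_visible p U \<phi> t \<longleftrightarrow>
     (\<forall>s\<in>positive_part U. 0 < s \<and> s < t \<and> \<phi> s \<in> integer_lattice \<longrightarrow>
        padic_val_vec p (\<phi> t) \<le> padic_val_vec p (\<phi> s))"

text \<open>For a visibility datum each point of the branch locus is \<open>\<phi>\<^sub>\<alpha>(t)\<close> for exactly one pair
  \<open>(\<alpha>, t)\<close> with \<open>t > 0\<close>, so the existential quantification over such pairs is unambiguous.\<close>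

definition visible_locus ::
    "(real ^ 'n::finite) set \<Rightarrow> 'i set \<Rightarrow> ('i \<Rightarrow> real set) \<Rightarrow> ('i \<Rightarrow> real \<Rightarrow> real ^ 'n)
      \<Rightarrow> (real ^ 'n) set" where
  "visible_locus X I U \<phi> =
     {P \<in> branch_locus X I U \<phi>.
        \<exists>\<alpha>\<in>I. \<exists>t\<in>positive_part (U \<alpha>). P = \<phi> \<alpha> t \<and> globally_visible (U \<alpha>) (\<phi> \<alpha>) t}"

definition padic_visible_locus ::
    "nat \<Rightarrow> (real ^ 'n::finite) set \<Rightarrow> 'i set \<Rightarrow> ('i \<Rightarrow> real set) \<Rightarrow> ('i \<Rightarrow> real \<Rightarrow> real ^ 'n)
      \<Rightarrow> (real ^ 'n) set" where
  "padic_visible_locus p X I U \<phi> =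
     {P \<in> branch_locus X I U \<phi>.
        \<exists>\<alpha>\<in>I. \<exists>t\<in>positive_part (U \<alpha>). P = \<phi> \<alpha> t \<and> padically_visible p (U \<alpha>) (\<phi> \<alpha>) t}"

end

theory Submission
  imports Defs
begin

text \<open>
  A globally visible point is \<open>p\<close>-adically visible for every \<open>p\<close> because no smaller integral
  parameter is left to compare it with. For the converse, suppose that \<open>\<phi>(t)\<close> is integral but
  that \<open>\<phi>(s)\<close> is integral for some \<open>0 < s < t\<close>, and put \<open>d = s / t < 1\<close>. Weighted homogeneity
  gives \<open>\<phi>\<^sub>i(s) = d ^ w\<^sub>i * \<phi>\<^sub>i(t)\<close>. The number \<open>d\<close> may be irrational, but \<open>d ^ w\<^sub>i\<close> is rational
  whenever \<open>\<phi>\<^sub>i(t) \<noteq> 0\<close>, and so \<open>d\<close> has a well-defined rational \<open>p\<close>-adic valuation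
  \<open>v\<^sub>p(d) = v\<^sub>p(d ^ w\<^sub>i) / w\<^sub>i\<close>, the same for all such \<open>i\<close>. Since \<open>d < 1\<close>, a prime \<open>p\<close> dividing the
  denominator of one of these powers has \<open>v\<^sub>p(d) < 0\<close>
  (lemma \<open>exists_prime_multiplicity_less\<close>). Because all weights are positive, this single prime
  lowers the valuation of every nonzero coordinate
  (lemma \<open>multiplicity_less_of_common_scaling\<close>), hence also their minimum: \<open>\<phi>(t)\<close> is not
  \<open>p\<close>-adically visible.

  Membership in the intersection of the \<open>p\<close>-adic loci provides a pair \<open>(\<alpha>, t)\<close> for each prime
  separately. These pairs all agree, since different branches are disjoint and each is injective
  on positive parameters (lemma \<open>branch_parameter_unique\<close>).
\<close>

text \<open>If no prime dropped in multiplicity then \<open>a\<close> would divide \<open>b\<close>, which its size forbids.\<close>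

lemma exists_prime_multiplicity_less:
  fixes a b :: int
  assumes "b \<noteq> 0" and "\<bar>b\<bar> < \<bar>a\<bar>"
  shows "\<exists>p::nat. prime p \<and> multiplicity (int p) b < multiplicity (int p) a"
proof (rule ccontr)
  assume contra: "\<not> ?thesis"
  have "multiplicity q a \<le> multiplicity q b" if "prime q" for q :: int
  proof -
    have q: "q = int (nat q)"
      using prime_gt_0_int[OF that] by simp
    then have "prime (nat q)"
      using that by (metis prime_nat_int_transfer)
    with contra have "multiplicity (int (nat q)) a \<le> multiplicity (int (nat q)) b"
      using not_le by blast
    with q show ?thesis by simp
  qed
  moreover have "a \<noteq> 0" using assms by auto
  ultimately have "a dvd b"
    using assms(1) by (intro multiplicity_le_imp_dvd) auto
  then show False
    using dvd_imp_le_int[OF assms(1)] assms(2) by fastforce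
qed

text \<open>The sign of \<open>v\<^sub>p(d)\<close> can be read off from any nonzero coordinate. As \<open>d\<close> itself need not be
  rational, it is eliminated from the two scaling relations by raising each of them to the
  weight of the other, which leaves an identity between integers.\<close>

lemma multiplicity_less_of_common_scaling:
  fixes p :: nat and d :: real and x y x' y' :: int and k l :: nat
  assumes p: "prime p" and d: "d > 0" and "k > 0" and "l > 0"
    and y: "real_of_int y = d ^ k * real_of_int x"
    and y': "real_of_int y' = d ^ l * real_of_int x'"
    and "x \<noteq> 0" and "x' \<noteq> 0"
    and less: "multiplicity (int p) y < multiplicity (int p) x"
  shows "multiplicity (int p) y' < multiplicity (int p) x'"
proof -
  let ?v = "multiplicity (int p)"
  have nz: "y \<noteq> 0" "y' \<noteq> 0"
    using y y' d \<open>x \<noteq> 0\<close> \<open>x' \<noteq> 0\<close> by auto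
  have pp: "prime_elem (int p)"
    using p by simp
  have "real_of_int (y' ^ k * x ^ l) = real_of_int (x' ^ k * y ^ l)"
    by (simp add: y y' power_mult_distrib mult.commute flip: power_mult)
  then have "y' ^ k * x ^ l = x' ^ k * y ^ l"
    by (simp only: of_int_eq_iff)
  then have "?v (y' ^ k * x ^ l) = ?v (x' ^ k * y ^ l)"
    by simp
  then have eq: "k * ?v y' + l * ?v x = k * ?v x' + l * ?v y"
    using nz pp \<open>x \<noteq> 0\<close> \<open>x' \<noteq> 0\<close>
    by (simp add: prime_elem_multiplicity_mult_distrib prime_elem_multiplicity_power_distrib)
  have "l * ?v y < l * ?v x"
    using less \<open>l > 0\<close> by simp
  with eq have "k * ?v y' < k * ?v x'"
    by linarith
  then show ?thesis by simp
qed

text \<open>The minimum defining the valuation of \<open>P\<close> is attained at a nonzero coordinate,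
  as \<open>P \<noteq> 0\<close>, and there the coordinate of \<open>Q\<close> has smaller valuation.\<close>

lemma exists_prime_padic_val_vec_less:
  fixes P Q :: "real ^ 'n::finite" and w :: "'n \<Rightarrow> nat"
  assumes P: "P \<in> integer_lattice" and Q: "Q \<in> integer_lattice" and "P \<noteq> 0"
    and d: "0 < d" "d < 1" and w: "\<And>i. 0 < w i"
    and scale: "\<And>i. Q $ i = d ^ w i * P $ i"
  shows "\<exists>p. prime p \<and> padic_val_vec p Q < padic_val_vec p P"
proof -
  define x where "x i = \<lfloor>P $ i\<rfloor>" for i
  define y where "y i = \<lfloor>Q $ i\<rfloor>" for i
  have x: "P $ i = real_of_int (x i)" and y: "Q $ i = real_of_int (y i)" for i
    using P Q by (auto simp: integer_lattice_def x_def y_def)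
  have yx: "real_of_int (y i) = d ^ w i * real_of_int (x i)" for i
    using scale[of i] by (simp add: x y)
  obtain i where i: "x i \<noteq> 0"
    using \<open>P \<noteq> 0\<close> x by (metis of_int_0 vec_eq_iff zero_index)
  have "d ^ w i < 1"
    using d w[of i] by (simp add: power_less_one_iff)
  then have "\<bar>real_of_int (y i)\<bar> < \<bar>real_of_int (x i)\<bar>"
    using d i by (simp add: yx abs_mult)
  then have "\<bar>y i\<bar> < \<bar>x i\<bar>"
    by linarith
  moreover have "y i \<noteq> 0"
    using yx[of i] d i by auto
  ultimately obtain p :: nat
    where p: "prime p" and less: "multiplicity (int p) (y i) < multiplicity (int p) (x i)"
    using exists_prime_multiplicity_less[of "y i" "x i"] by blast
  have "Min (range (\<lambda>j. padic_val p (x j))) \<in> range (\<lambda>j. padic_val p (x j))"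
    by (intro Min_in) auto
  then obtain j where j: "Min (range (\<lambda>j. padic_val p (x j))) = padic_val p (x j)"
    by (rule rangeE)
  have "padic_val p (x j) \<le> padic_val p (x i)"
    unfolding j[symmetric] by (intro Min_le) auto
  then have xj: "x j \<noteq> 0"
    using i by (auto simp: padic_val_def)
  then have yj: "y j \<noteq> 0"
    using yx[of j] d by auto
  have "multiplicity (int p) (y j) < multiplicity (int p) (x j)"
    using multiplicity_less_of_common_scaling[OF p d(1) w w yx yx i xj less] .
  then have "padic_val p (y j) < padic_val p (x j)"
    using xj yj by (simp add: padic_val_def)
  moreover have "padic_val_vec p Q \<le> padic_val p (y j)"
    unfolding padic_val_vec_def y_def by (intro Min_le) auto
  moreover have "padic_val_vec p P = padic_val p (x j)"
    using j unfolding padic_val_vec_def x_def .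
  ultimately have "padic_val_vec p Q < padic_val_vec p P"
    by simp
  with p show ?thesis by blast
qed

lemma branch_parameter_unique:
  assumes "visibility_datum X I U \<phi>"
    and "\<alpha> \<in> I" "t \<in> positive_part (U \<alpha>)"
    and "\<beta> \<in> I" "s \<in> positive_part (U \<beta>)"
    and eq: "\<phi> \<alpha> t = \<phi> \<beta> s"
  shows "\<alpha> = \<beta> \<and> t = s"
proof -
  have "\<alpha> = \<beta>"
  proof (rule ccontr)
    assume "\<alpha> \<noteq> \<beta>"
    then have "\<phi> \<alpha> ` positive_part (U \<alpha>) \<inter> \<phi> \<beta> ` positive_part (U \<beta>) = {}"
      using assms(1,2,4) unfolding visibility_datum_def by blast
    with assms(3,5) eq show False by blast
  qed
  have "ordered_branch X (U \<alpha>) (\<phi> \<alpha>)"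
    using assms(1,2) unfolding visibility_datum_def by (elim conjE) (rule bspec)
  then have "inj_on (\<phi> \<alpha>) (positive_part (U \<alpha>))"
    unfolding ordered_branch_def by (elim conjE)
  then have "t = s"
    using assms(3,5) eq unfolding \<open>\<alpha> = \<beta>\<close> by (simp add: inj_on_eq_iff)
  with \<open>\<alpha> = \<beta>\<close> show ?thesis ..
qed

theorem theorem1p1:
  fixes X :: "(real ^ 'n::finite) set"
    and I :: "'i set"
    and U :: "'i \<Rightarrow> real set"
    and \<phi> :: "'i \<Rightarrow> real \<Rightarrow> real ^ 'n"
    and w :: "'n \<Rightarrow> nat"
  assumes "affine_variety_over_rat X" and "0 \<in> X"
    and "visibility_datum X I U \<phi>"
    and "\<forall>i. 0 < w i"
    and "\<forall>\<alpha>\<in>I. \<forall>t\<in>U \<alpha>. \<forall>d>0. d * t \<in> U \<alpha> \<longrightarrow>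
           \<phi> \<alpha> (d * t) = (\<chi> i. d ^ w i * \<phi> \<alpha> t $ i)"
  shows "visible_locus X I U \<phi> = (\<Inter>p\<in>{p. prime p}. padic_visible_locus p X I U \<phi>)"
proof
  show "visible_locus X I U \<phi> \<subseteq> (\<Inter>p\<in>{p. prime p}. padic_visible_locus p X I U \<phi>)"
    unfolding visible_locus_def padic_visible_locus_def globally_visible_def padically_visible_def
    by blast
next
  show "(\<Inter>p\<in>{p. prime p}. padic_visible_locus p X I U \<phi>) \<subseteq> visible_locus X I U \<phi>"
  proof
    fix P assume P: "P \<in> (\<Inter>p\<in>{p. prime p}. padic_visible_locus p X I U \<phi>)"
    then have locus: "P \<in> branch_locus X I U \<phi>"
      using two_is_prime_nat unfolding padic_visible_locus_def by blast
    then obtain \<alpha> t where \<alpha>: "\<alpha> \<in> I" and t: "t \<in> positive_part (U \<alpha>)"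
      and Pt: "P = \<phi> \<alpha> t" and int: "P \<in> integer_lattice"
      unfolding branch_locus_def by auto
    have tU: "t \<in> U \<alpha>" "t > 0"
      using t by (auto simp: positive_part_def)
    have padic: "padically_visible p (U \<alpha>) (\<phi> \<alpha>) t" if p: "prime p" for p
    proof -
      obtain \<beta> s where "\<beta> \<in> I" "s \<in> positive_part (U \<beta>)" "P = \<phi> \<beta> s"
        and vis: "padically_visible p (U \<beta>) (\<phi> \<beta>) s"
        using P p unfolding padic_visible_locus_def by auto
      then have "\<alpha> = \<beta> \<and> t = s"
        using branch_parameter_unique[OF assms(3) \<alpha> t] Pt by metis
      with vis show ?thesis by simp
    qed
    have "globally_visible (U \<alpha>) (\<phi> \<alpha>) t"
      unfolding globally_visible_def
    proof
      assume "\<exists>s\<in>positive_part (U \<alpha>). 0 < s \<and> s < t \<and> \<phi> \<alpha> s \<in> integer_lattice"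
      then obtain s where s: "s \<in> positive_part (U \<alpha>)" "0 < s" "s < t"
        and int_s: "\<phi> \<alpha> s \<in> integer_lattice"
        by blast
      define d where "d = s / t"
      have d: "0 < d" "d < 1" and dt: "d * t = s"
        using s tU by (auto simp: d_def)
      have "d * t \<in> U \<alpha>"
        using s(1) by (simp add: dt positive_part_def)
      then have "\<phi> \<alpha> (d * t) = (\<chi> i. d ^ w i * \<phi> \<alpha> t $ i)"
        using assms(5) \<alpha> tU(1) d(1) by blast
      then have scale: "\<phi> \<alpha> s $ i = d ^ w i * \<phi> \<alpha> t $ i" for i
        by (simp add: dt)
      have "\<forall>t\<in>U \<alpha>. \<phi> \<alpha> t = 0 \<longrightarrow> t = 0"
        using assms(3) \<alpha> unfolding visibility_datum_def by blast
      with tU have "\<phi> \<alpha> t \<noteq> 0"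
        by auto
      then have "\<exists>p. prime p \<and> padic_val_vec p (\<phi> \<alpha> s) < padic_val_vec p (\<phi> \<alpha> t)"
        using int int_s Pt d assms(4) scale
        by (intro exists_prime_padic_val_vec_less[where d = d and w = w]) simp_all
      then obtain p where "prime p" "padic_val_vec p (\<phi> \<alpha> s) < padic_val_vec p (\<phi> \<alpha> t)"
        by blast
      with padic s int_s show False
        unfolding padically_visible_def by (meson not_le)
    qed
    with locus \<alpha> t Pt show "P \<in> visible_locus X I U \<phi>"
      unfolding visible_locus_def by blast
  qed
qed

end
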